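(* Let $\alpha,q\in(-1,1)$. The probability measure $\nu_{\alpha,q}$ has a radial Bargmann representation if and only if either (i) $q\ge 0$ and $\alpha\le q$, or (ii) $\alpha=q\neq 0$. Moreover, in these cases the radial measure is unique and is given by $$ \rho_{\nu_{\alpha,q}}= \begin{cases} -\alpha\,\delta_0+(1+\alpha)\,\delta_1 & (\alpha\le q=0),\\[4pt] \displaystyle (-\alpha,q;q)_\infty\sum_{n=0}^\infty \frac{q^n}{(q;q)_n}\,h_n(-\alpha q^{-1}\mid q)\,\delta_{(1-q)^{-1/2}q^{n/2}} & (q>0,\ \alpha<q),\\[4pt] \displaystyle (q^2;q^2)_\infty\sum_{n=0}^\infty \frac{q^{2n}}{(q^2;q^2)_n}\,\delta_{(1-q)^{-1/2}|q|^n} & (\alpha=q\neq 0). \end{cases} $$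
   Context: Convention: $0^0=1$. $\delta_x$ is the Dirac mass at $x$. For $n\ge1$, $[n]_q=1+q+\cdots+q^{n-1}$; $[0]_q!=1$ and $[k]_q!=\prod_{\ell=1}^k[\ell]_q$. The $q$-shifted factorials are $(a;q)_0=1$, $(a;q)_k=\prod_{\ell=1}^k(1-aq^{\ell-1})$ for $k=1,2,\dots,\infty$, and $(a_1,a_2;q)_k=(a_1;q)_k(a_2;q)_k$. The Rogers–Szegő polynomials are $h_n(z\mid q)=\sum_{\ell=0}^n \frac{(q;q)_n}{(q;q)_\ell (q;q)_{n-\ell}}z^\ell$. For $\alpha,q\in(-1,1)$, $\nu_{\alpha,q}$ is the probability measure on $\mathbb{R}$ that is the orthogonality measure of the ($q$-Meixner–Pollaczek) monic polynomials defined by $P_0(x)=1$, $P_1(x)=x$, $xP_n(x)=P_{n+1}(x)+\omega_nP_{n-1}(x)$ for $n\ge1$, where $\omega_n=(1+\alpha q^{n-1})[n]_q$; that is, $\int P_mP_n\,d\nu_{\alpha,q}=\delta_{m,n}\,\omega_1\cdots\omega_n$. A Bargmann representation of $\nu_{\alpha,q}$ is a probability measure $\gamma$ on $\mathbb{C}$ with $\int_{\mathbb{C}}\overline{z}^m z^n\,\gamma(d^2z)=\delta_{m,n}\,\omega_1\cdots\omega_n$ for all integers $m,n\ge0$ (empty product $=1$). It is radial if $\gamma(d^2z)=\frac{1}{2\pi}\lambda_{[0,2\pi)}(d\theta)\,\rho(dr)$ in polar coordinates $z=re^{i\theta}$, $r\ge0$, $\theta\in[0,2\pi)$, where $\lambda_{[0,2\pi)}$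 is Lebesgue measure on $[0,2\pi)$ and $\rho$ is a nonnegative measure on $[0,\infty)$; $\rho$ is then called the radial measure and is denoted $\rho_{\nu_{\alpha,q}}$. Equivalently, $\nu_{\alpha,q}$ has a radial Bargmann representation with radial measure $\rho$ if and only if $\rho$ is a nonnegative measure on $[0,\infty)$ with $\int_0^\infty r^{2k}\,\rho(dr)=(-\alpha;q)_k[k]_q!$ for all integers $k\ge0$. *)

theory Defs
  imports "HOL-Probability.Probability" "HOL-Computational_Algebra.Polynomial"
begin

definition q_int :: "real \<Rightarrow> nat \<Rightarrow> real" where
  "q_int q n = (\<Sum>i<n. q ^ i)"

definition q_poch :: "real \<Rightarrow> real \<Rightarrow> nat \<Rightarrow> real" where
  "q_poch a q k = (\<Prod>l=1..k. 1 - a * q ^ (l - 1))"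

definition q_poch_inf :: "real \<Rightarrow> real \<Rightarrow> real" where
  "q_poch_inf a q = (\<Prod>l. 1 - a * q ^ l)"

definition rogers_szego :: "nat \<Rightarrow> real \<Rightarrow> real \<Rightarrow> real" where
  "rogers_szego n z q =
     (\<Sum>l\<le>n. q_poch q q n / (q_poch q q l * q_poch q q (n - l)) * z ^ l)"

text \<open>The value at index \<open>0\<close> of a coefficient sequence \<open>\<omega>\<close> is never used.\<close>

fun monic_orth_poly :: "(nat \<Rightarrow> real) \<Rightarrow> nat \<Rightarrow> real poly" where
  "monic_orth_poly \<omega> 0 = 1"
| "monic_orth_poly \<omega> (Suc 0) = [:0, 1:]"
| "monic_orth_poly \<omega> (Suc (Suc n)) =
     [:0, 1:] * monic_orth_poly \<omega> (Suc n) - smult (\<omega> (Suc n)) (monic_orth_poly \<omega> n)"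

definition orthogonality_measure :: "(nat \<Rightarrow> real) \<Rightarrow> real measure \<Rightarrow> bool" where
  "orthogonality_measure \<omega> \<nu> \<longleftrightarrow>
     prob_space \<nu> \<and> sets \<nu> = sets borel \<and>
     (\<forall>m n. integrable \<nu> (\<lambda>x. poly (monic_orth_poly \<omega> m) x * poly (monic_orth_poly \<omega> n) x) \<and>
        (\<integral>x. poly (monic_orth_poly \<omega> m) x * poly (monic_orth_poly \<omega> n) x \<partial>\<nu>) =
          (if m = n then \<Prod>k=1..n. \<omega> k else 0))"

definition mp_omega :: "real \<Rightarrow> real \<Rightarrow> nat \<Rightarrow> real" where
  "mp_omega \<alpha> q n = (1 + \<alpha> * q ^ (n - 1)) * q_int q n"

text \<open>The products \<open>\<omega> 1 \<cdots> \<omega> n\<close> are determined by \<open>\<nu>\<close>: they are the squared norms in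
  \<open>L\<^sup>2(\<nu>)\<close> of its monic orthogonal polynomials. So the choice of \<open>\<omega>\<close> below is immaterial.\<close>

definition bargmann_representation :: "real measure \<Rightarrow> complex measure \<Rightarrow> bool" where
  "bargmann_representation \<nu> \<gamma> \<longleftrightarrow>
     prob_space \<gamma> \<and> sets \<gamma> = sets borel \<and>
     (\<exists>\<omega>. orthogonality_measure \<omega> \<nu> \<and>
        (\<forall>m n. integrable \<gamma> (\<lambda>z. cnj z ^ m * z ^ n) \<and>
           (\<integral>z. cnj z ^ m * z ^ n \<partial>\<gamma>) =
             (if m = n then complex_of_real (\<Prod>k=1..n. \<omega> k) else 0)))"

text \<open>Measures on \<open>[0, \<infinity>)\<close> are rendered as Borel measures on the real line that give no mass
  to the negative half-line. No finiteness of \<open>\<rho>\<close> is required: if \<open>\<gamma>\<close> is a probability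
  measure, then the total mass of \<open>\<rho>\<close> is necessarily \<open>1\<close>.\<close>

definition radial_with :: "complex measure \<Rightarrow> real measure \<Rightarrow> bool" where
  "radial_with \<gamma> \<rho> \<longleftrightarrow>
     sets \<rho> = sets borel \<and> emeasure \<rho> {..<0} = 0 \<and>
     \<gamma> = distr (uniform_measure lborel {0..<2 * pi} \<Otimes>\<^sub>M \<rho>) borel
           (\<lambda>(\<theta>, r). complex_of_real r * cis \<theta>)"

definition radial_bargmann_measure :: "real measure \<Rightarrow> real measure \<Rightarrow> bool" where
  "radial_bargmann_measure \<nu> \<rho> \<longleftrightarrow>
     (\<exists>\<gamma>. bargmann_representation \<nu> \<gamma> \<and> radial_with \<gamma> \<rho>)"

text \<open>The measure \<open>\<Sum>i\<in>I. w i \<delta>\<^bsub>x i\<^esub>\<close>, for nonnegative weights \<open>w\<close>.\<close>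

definition atomic_measure :: "'i set \<Rightarrow> ('i \<Rightarrow> real) \<Rightarrow> ('i \<Rightarrow> real) \<Rightarrow> real measure" where
  "atomic_measure I w x = distr (density (count_space I) (\<lambda>i. ennreal (w i))) borel x"

end

theory Submission
  imports Defs
begin

text \<open>
  Write \<open>m\<^sub>n = \<omega>\<^sub>1 \<cdots> \<omega>\<^sub>n\<close>. A rotation invariant \<open>\<gamma>\<close> has vanishing
  mixed moments for \<open>m \<noteq> n\<close>, so a radial Bargmann representation is the same thing as a solution
  \<open>\<rho>\<close> on \<open>[0, \<infinity>)\<close> of the moment problem \<open>\<integral> r\<^bsup>2n\<^esup> d\<rho> = m\<^sub>n\<close>
  (\<open>radial_bargmann_measure_iff_even_moments\<close>). The theorem is about this moment problem.

  Uniqueness. The \<open>m\<^sub>n\<close> grow at most geometrically, so the characteristic function of the image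
  of \<open>\<rho>\<close> under \<open>r \<mapsto> r\<^sup>2\<close> is the sum of its moment series, and \<open>\<rho>\<close> is determined
  by the \<open>m\<^sub>n\<close> (\<open>even_moments_unique\<close>).

  Necessity. By the Cauchy--Schwarz inequality moments are log-convex, that is, the ratios
  \<open>\<omega>\<^bsub>n+1\<^esub> = m\<^bsub>n+1\<^esub> / m\<^sub>n\<close> increase. Here
  \<open>(1 - q) \<omega>\<^bsub>n+1\<^esub> = (1 + \<alpha> q\<^sup>n) (1 - q\<^bsup>n+1\<^esup>)\<close> tends to \<open>1\<close>, so all these
  numbers are at most \<open>1\<close>, which says
  \<open>q\<^sup>n (\<alpha> - q - \<alpha> q\<^bsup>n+1\<^esup>) \<le> 0\<close> for all \<open>n\<close>. For \<open>q > 0\<close> large \<open>n\<close> give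
  \<open>\<alpha> \<le> q\<close>, for \<open>q = 0\<close> already \<open>n = 0\<close> does, and for \<open>q < 0\<close> the even
  and the odd \<open>n\<close> give \<open>\<alpha> \<le> q\<close> and \<open>\<alpha> \<ge> q\<close>
  (\<open>even_moments_mp_omega_imp\<close>).

  Existence. For \<open>q = 0\<close> the \<open>m\<^sub>n\<close> with \<open>n \<ge> 1\<close> are all equal to
  \<open>1 + \<alpha>\<close>, which atoms at \<open>0\<close> and \<open>1\<close> realize. For \<open>q \<noteq> 0\<close> the
  moments of the explicit measures are computed from Euler's expansion
  \<open>\<Sum>n. t\<^sup>n / (q; q)\<^sub>n = 1 / (t; q)\<^sub>\<infinity>\<close>. For \<open>\<alpha> = q\<close> one has
  \<open>(-q; q)\<^sub>n (q; q)\<^sub>n = (q\<^sup>2; q\<^sup>2)\<^sub>n\<close>, and the expansion in base \<open>q\<^sup>2\<close>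
  suffices. For \<open>0 < q\<close> and \<open>\<alpha> < q\<close> the product of two such expansions is the generating
  function of the Rogers--Szegoe polynomials (\<open>rs_coeff_sums\<close>), and their values at
  \<open>- \<alpha> / q > -1\<close> are nonnegative by their three-term recurrence (\<open>rs_coeff_nonneg\<close>).
\<close>

section \<open>Euler's q-exponential series\<close>

lemma q_poch_0 [simp]: "q_poch a q 0 = 1"
  by (simp add: q_poch_def)

lemma q_poch_Suc: "q_poch a q (Suc k) = q_poch a q k * (1 - a * q ^ k)"
  by (simp add: q_poch_def)

lemma q_poch_eq_prod_lessThan: "q_poch a q k = (\<Prod>l<k. 1 - a * q ^ l)"
  by (induction k) (simp_all add: q_poch_Suc)

lemma abs_mult_power_less_1:
  fixes a q :: real
  assumes "\<bar>a\<bar> < 1" "\<bar>q\<bar> < 1"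
  shows "\<bar>a * q ^ l\<bar> < 1"
proof -
  have "\<bar>a * q ^ l\<bar> \<le> \<bar>a\<bar>"
    using assms by (simp add: abs_mult power_abs power_le_one mult_left_le)
  then show ?thesis using assms by simp
qed

lemma q_poch_pos:
  assumes "\<bar>a\<bar> < 1" "\<bar>q\<bar> < 1"
  shows "q_poch a q k > 0"
  unfolding q_poch_eq_prod_lessThan
proof (rule prod_pos)
  fix l show "0 < 1 - a * q ^ l" using abs_mult_power_less_1[OF assms, of l] by linarith
qed

lemma q_poch_LIMSEQ:
  assumes "\<bar>q\<bar> < 1"
  shows "(\<lambda>k. q_poch a q k) \<longlonglongrightarrow> q_poch_inf a q"
proof -
  have "summable (\<lambda>l. \<bar>a\<bar> * \<bar>q\<bar> ^ l)"
    using assms by (intro summable_mult summable_geometric) simp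
  then have "summable (\<lambda>l. norm ((1 - a * q ^ l) - 1))"
    by (simp add: abs_mult power_abs)
  then have "convergent_prod (\<lambda>l. 1 - a * q ^ l)"
    by (intro abs_convergent_prod_imp_convergent_prod)
       (simp add: abs_convergent_prod_conv_summable)
  from convergent_prod_LIMSEQ[OF this] show ?thesis
    unfolding q_poch_inf_def q_poch_eq_prod_lessThan LIMSEQ_lessThan_iff_atMost .
qed

lemma q_poch_inf_nonneg:
  assumes "\<bar>a\<bar> < 1" "\<bar>q\<bar> < 1"
  shows "q_poch_inf a q \<ge> 0"
  by (rule LIMSEQ_le_const[OF q_poch_LIMSEQ[OF assms(2)]])
     (auto intro: less_imp_le[OF q_poch_pos[OF assms]])

text \<open>
  Euler's \<open>q\<close>-exponential \<open>e\<^sub>q(t)\<close>; its product form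
  \<open>1 / (t; q)\<^sub>\<infinity>\<close> is proved below.
\<close>

definition q_exp :: "real \<Rightarrow> real \<Rightarrow> real" where
  "q_exp q t = (\<Sum>n. t ^ n / q_poch q q n)"

text \<open>
  Ratio test: the quotient of consecutive terms tends to \<open>\<bar>t\<bar> < 1\<close>.
\<close>

lemma summable_norm_q_exp:
  assumes q: "\<bar>q\<bar> < 1" and t: "\<bar>t\<bar> < 1"
  shows "summable (\<lambda>n. norm (t ^ n / q_poch q q n))"
proof -
  define c where "c = (1 + \<bar>t\<bar>) / 2"
  have c: "\<bar>t\<bar> < c" "c < 1" using t by (auto simp: c_def)
  have "(\<lambda>n. \<bar>t\<bar> / (1 - q * q ^ n)) \<longlonglongrightarrow> \<bar>t\<bar> / (1 - q * 0)"
    by (intro tendsto_intros LIMSEQ_power_zero) (use q in auto)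
  then have "eventually (\<lambda>n. \<bar>t\<bar> / (1 - q * q ^ n) < c) sequentially"
    using c by (intro order_tendstoD(2)) auto
  then obtain N where N: "\<And>n. n \<ge> N \<Longrightarrow> \<bar>t\<bar> / (1 - q * q ^ n) < c"
    by (auto simp: eventually_sequentially)
  show ?thesis
  proof (rule summable_ratio_test[OF c(2)])
    fix n assume "N \<le> n"
    have pos: "q_poch q q n > 0" "1 - q * q ^ n > 0"
      using q_poch_pos[OF q q] abs_mult_power_less_1[OF q q, of n] by auto
    have "norm (norm (t ^ Suc n / q_poch q q (Suc n))) =
        \<bar>t\<bar> / (1 - q * q ^ n) * norm (t ^ n / q_poch q q n)"
      using pos by (simp add: q_poch_Suc abs_mult power_abs)
    also have "\<dots> \<le> c * norm (t ^ n / q_poch q q n)"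
      using N[OF \<open>N \<le> n\<close>] by (intro mult_right_mono) auto
    finally show "norm (norm (t ^ Suc n / q_poch q q (Suc n)))
        \<le> c * norm (norm (t ^ n / q_poch q q n))" by simp
  qed
qed

lemma q_exp_sums:
  assumes "\<bar>q\<bar> < 1" "\<bar>t\<bar> < 1"
  shows "(\<lambda>n. t ^ n / q_poch q q n) sums q_exp q t"
  unfolding q_exp_def
  by (rule summable_sums[OF summable_norm_cancel[OF summable_norm_q_exp[OF assms]]])

text \<open>
  In the difference of the series at \<open>t\<close> and at \<open>t * q\<close>, the factor \<open>1 - q ^ n\<close> of
  the term of index \<open>n\<close> cancels the last factor of the denominator, which leaves the series at
  \<open>t\<close> shifted by one.
\<close>

lemma q_exp_functional_eq:
  assumes q: "\<bar>q\<bar> < 1" and t: "\<bar>t\<bar> < 1"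
  shows "(1 - t) * q_exp q t = q_exp q (t * q)"
proof -
  have tq: "\<bar>t * q\<bar> < 1" using abs_mult_power_less_1[OF t q, of 1] by simp
  let ?d = "\<lambda>n. t ^ n / q_poch q q n - (t * q) ^ n / q_poch q q n"
  have "?d sums (q_exp q t - q_exp q (t * q))"
    by (intro sums_diff q_exp_sums q t tq)
  then have "(\<lambda>n. ?d (Suc n)) sums (q_exp q t - q_exp q (t * q))"
    by (subst sums_Suc_iff) simp
  moreover have "?d (Suc n) = t * (t ^ n / q_poch q q n)" for n
  proof -
    have "q_poch q q n > 0" "1 - q * q ^ n > 0"
      using q_poch_pos[OF q q] abs_mult_power_less_1[OF q q, of n] by auto
    then show ?thesis by (simp add: q_poch_Suc power_mult_distrib divide_simps) (simp add: algebra_simps)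
  qed
  ultimately have "q_exp q t - q_exp q (t * q) = t * q_exp q t"
    using sums_mult[OF q_exp_sums[OF q t], of t] sums_unique2 by auto
  then show ?thesis by (simp add: algebra_simps)
qed

lemma q_poch_mult_q_exp:
  assumes q: "\<bar>q\<bar> < 1" and t: "\<bar>t\<bar> < 1"
  shows "q_poch t q k * q_exp q t = q_exp q (t * q ^ k)"
proof (induction k)
  case (Suc k)
  have "q_poch t q (Suc k) * q_exp q t = (1 - t * q ^ k) * (q_poch t q k * q_exp q t)"
    by (simp add: q_poch_Suc)
  also have "\<dots> = q_exp q (t * q ^ k * q)"
    using q_exp_functional_eq[OF q abs_mult_power_less_1[OF t q, of k]] Suc.IH by simp
  finally show ?case by (simp add: mult_ac)
qed simp

text \<open>
  The limit of the iterated functional equation, since \<open>q_exp q\<close> is continuous at \<open>0\<close> with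
  value \<open>1\<close>.
\<close>

lemma q_poch_inf_mult_q_exp:
  assumes q: "\<bar>q\<bar> < 1" and t: "\<bar>t\<bar> < 1"
  shows "q_poch_inf t q * q_exp q t = 1"
proof -
  have "summable (\<lambda>n. (1 / q_poch q q n) * (1 / 2) ^ n)"
    using summable_norm_cancel[OF summable_norm_q_exp[OF q, of "1 / 2"]] by simp
  then have "isCont (\<lambda>x. \<Sum>n. (1 / q_poch q q n) * x ^ n) 0"
    by (rule isCont_powser) simp
  then have cont: "isCont (q_exp q) 0" by (simp add: q_exp_def[abs_def])
  have q_exp_0: "q_exp q 0 = 1"
    unfolding q_exp_def using powser_zero[of "\<lambda>n. 1 / q_poch q q n"] by simp
  have "(\<lambda>k. t * q ^ k) \<longlonglongrightarrow> t * 0"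
    by (intro tendsto_intros LIMSEQ_power_zero) (use q in auto)
  then have "(\<lambda>k. q_exp q (t * q ^ k)) \<longlonglongrightarrow> q_exp q 0"
    by (intro isCont_tendsto_compose[OF cont]) simp
  moreover have "(\<lambda>k. q_poch t q k * q_exp q t) \<longlonglongrightarrow> q_poch_inf t q * q_exp q t"
    by (intro tendsto_intros q_poch_LIMSEQ q)
  ultimately show ?thesis
    unfolding q_poch_mult_q_exp[OF q t] q_exp_0 by (rule LIMSEQ_unique[rotated])
qed

text \<open>
  Finite shifted factorials as values of one series at the points of a geometric progression. This
  is what turns them into the moments of a measure with atoms on a geometric progression.
\<close>

lemma q_poch_inf_mult_q_exp_shift:
  assumes "\<bar>q\<bar> < 1" "\<bar>t\<bar> < 1"
  shows "q_poch_inf t q * q_exp q (t * q ^ k) = q_poch t q k"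
  using q_poch_inf_mult_q_exp[OF assms] q_poch_mult_q_exp[OF assms, of k]
  by (metis mult.assoc mult.commute mult_1)

section \<open>Rogers--Szegoe polynomials\<close>

text \<open>
  The coefficient \<open>h\<^sub>n(z | q) / (q; q)\<^sub>n\<close> of the generating function of the
  Rogers--Szegoe polynomials, as the Cauchy product of the coefficients of two
  \<open>q\<close>-exponentials.
\<close>

definition rs_coeff :: "real \<Rightarrow> real \<Rightarrow> nat \<Rightarrow> real" where
  "rs_coeff q z n = (\<Sum>l\<le>n. z ^ l / q_poch q q l * (1 / q_poch q q (n - l)))"

lemma rogers_szego_eq_rs_coeff:
  assumes "\<bar>q\<bar> < 1"
  shows "rogers_szego n z q / q_poch q q n = rs_coeff q z n"
  using q_poch_pos[OF assms assms, of n]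
  by (simp add: rogers_szego_def rs_coeff_def sum_divide_distrib)

lemma rs_coeff_sums:
  assumes q: "\<bar>q\<bar> < 1" and t: "\<bar>t\<bar> < 1" and zt: "\<bar>z * t\<bar> < 1"
  shows "(\<lambda>n. t ^ n * rs_coeff q z n) sums (q_exp q (z * t) * q_exp q t)"
proof -
  have "(\<lambda>n. \<Sum>l\<le>n. ((z * t) ^ l / q_poch q q l) * (t ^ (n - l) / q_poch q q (n - l)))
      sums (q_exp q (z * t) * q_exp q t)"
    unfolding q_exp_def
    by (intro Cauchy_product_sums summable_norm_q_exp q t zt)
  moreover have "(\<Sum>l\<le>n. ((z * t) ^ l / q_poch q q l) * (t ^ (n - l) / q_poch q q (n - l)))
      = t ^ n * rs_coeff q z n" for n
    unfolding rs_coeff_def sum_distrib_left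
    by (intro sum.cong refl) (simp add: power_mult_distrib flip: power_add)
  ultimately show ?thesis by simp
qed

lemma inverse_q_poch_Suc:
  assumes "\<bar>q\<bar> < 1"
  shows "(1 - q ^ Suc l) / q_poch q q (Suc l) = 1 / q_poch q q l"
  using q_poch_pos[OF assms assms, of l] abs_mult_power_less_1[OF assms assms, of l]
  by (auto simp: q_poch_Suc)

text \<open>
  The sum \<open>E\<close> is \<open>rs_coeff\<close> with one more factor \<open>q ^ (n - l)\<close> in its terms. Both
  factors \<open>1 - q ^ (n - l)\<close> and \<open>1 - q ^ l\<close> can be absorbed in a denominator, which lowers
  the index by one. This gives two relations between \<open>E\<close> and \<open>rs_coeff\<close>;
  eliminating \<open>E\<close> yields the recurrence.
\<close>

lemma rs_coeff_recurrence:
  assumes q: "\<bar>q\<bar> < 1"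
  shows "(1 - q ^ Suc (Suc n)) * rs_coeff q z (Suc (Suc n)) =
    (1 + z) * rs_coeff q z (Suc n) - z * rs_coeff q z n"
proof -
  let ?a = "\<lambda>l. 1 / q_poch q q l"
  define E where "E m = (\<Sum>l\<le>m. z ^ l * ?a l * (q ^ (m - l) * ?a (m - l)))" for m
  have diff: "rs_coeff q z (Suc m) - E (Suc m) = rs_coeff q z m" for m
  proof -
    have "rs_coeff q z (Suc m) - E (Suc m) =
        (\<Sum>l\<le>Suc m. z ^ l * ?a l * ((1 - q ^ (Suc m - l)) * ?a (Suc m - l)))"
      unfolding rs_coeff_def E_def
      by (simp only: sum_subtractf[symmetric]) (intro sum.cong refl, simp add: diff_divide_distrib left_diff_distrib right_diff_distrib)
    also have "\<dots> = (\<Sum>l\<le>m. z ^ l * ?a l * ((1 - q ^ (Suc m - l)) * ?a (Suc m - l)))"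
      by simp
    also have "\<dots> = (\<Sum>l\<le>m. z ^ l * ?a l * ?a (m - l))"
    proof (intro sum.cong refl)
      fix l assume "l \<in> {..m}"
      then have "Suc m - l = Suc (m - l)" by auto
      then show "z ^ l * ?a l * ((1 - q ^ (Suc m - l)) * ?a (Suc m - l)) = z ^ l * ?a l * ?a (m - l)"
        using inverse_q_poch_Suc[OF q, of "m - l"] by simp
    qed
    finally show ?thesis by (simp add: rs_coeff_def)
  qed
  have shift: "E (Suc m) - q ^ Suc m * rs_coeff q z (Suc m) = z * E m" for m
  proof -
    have "E (Suc m) - q ^ Suc m * rs_coeff q z (Suc m) =
        (\<Sum>l\<le>Suc m. z ^ l * ((1 - q ^ l) * ?a l) * (q ^ (Suc m - l) * ?a (Suc m - l)))"
      unfolding rs_coeff_def E_def sum_distrib_left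
    proof (simp only: sum_subtractf[symmetric], intro sum.cong refl)
      fix l assume "l \<in> {..Suc m}"
      then have "q ^ Suc m = q ^ l * q ^ (Suc m - l)" by (simp flip: power_add)
      then show "z ^ l * ?a l * (q ^ (Suc m - l) * ?a (Suc m - l)) -
          q ^ Suc m * (z ^ l / q_poch q q l * ?a (Suc m - l)) =
          z ^ l * ((1 - q ^ l) * ?a l) * (q ^ (Suc m - l) * ?a (Suc m - l))"
        by (simp only:) (simp add: diff_divide_distrib left_diff_distrib right_diff_distrib mult_ac)
    qed
    also have "\<dots> = (\<Sum>l\<le>m. z ^ Suc l * ((1 - q ^ Suc l) * ?a (Suc l)) * (q ^ (m - l) * ?a (m - l)))"
      by (subst sum.atMost_Suc_shift) simp
    also have "\<dots> = z * E m"
      unfolding E_def sum_distrib_left using inverse_q_poch_Suc[OF q]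
      by (intro sum.cong refl) simp
    finally show ?thesis .
  qed
  have "(1 - q ^ Suc (Suc n)) * rs_coeff q z (Suc (Suc n)) =
      (rs_coeff q z (Suc (Suc n)) - E (Suc (Suc n))) +
      (E (Suc (Suc n)) - q ^ Suc (Suc n) * rs_coeff q z (Suc (Suc n)))"
    by (simp only: left_diff_distrib mult_1)
  also have "\<dots> = rs_coeff q z (Suc n) + z * (rs_coeff q z (Suc n) - rs_coeff q z n)"
    unfolding diff shift using diff[of n] by simp
  finally show ?thesis by (simp only: distrib_right right_diff_distrib mult_1)
qed

text \<open>
  For \<open>z \<ge> 0\<close> all terms are nonnegative; for \<open>-1 \<le> z < 0\<close> the coefficients
  \<open>1 + z\<close> and \<open>- z\<close> of the recurrence are.
\<close>

lemma rs_coeff_nonneg: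
  assumes q: "\<bar>q\<bar> < 1" and z: "z \<ge> -1"
  shows "rs_coeff q z n \<ge> 0"
proof (cases "z \<ge> 0")
  case True
  then show ?thesis unfolding rs_coeff_def
    using q_poch_pos[OF q q] by (intro sum_nonneg) (simp add: less_imp_le)
next
  case False
  show ?thesis
  proof (induction n rule: induct_nat_012)
    case 0 show ?case by (simp add: rs_coeff_def)
  next
    case 1 show ?case using z q_poch_pos[OF q q, of 1]
      by (simp add: rs_coeff_def flip: add_divide_distrib)
  next
    case (ge2 n)
    have "0 \<le> 1 + z" "0 \<le> - z" using False z by auto
    then have "0 \<le> (1 + z) * rs_coeff q z (Suc n) + (- z) * rs_coeff q z n"
      using ge2 by (metis add_nonneg_nonneg mult_nonneg_nonneg)
    then have "0 \<le> (1 - q ^ Suc (Suc n)) * rs_coeff q z (Suc (Suc n))"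
      unfolding rs_coeff_recurrence[OF q] by simp
    moreover have "1 - q ^ Suc (Suc n) > 0"
      using abs_mult_power_less_1[OF q q, of "Suc n"] by simp
    ultimately show ?case by (simp only: zero_le_mult_iff) auto
  qed
qed

section \<open>Even moments on the half-line\<close>

text \<open>
  The moments are stated as integrals of nonnegative functions, which are defined for every measure
  and include integrability as finiteness.
\<close>

definition even_moments :: "(nat \<Rightarrow> real) \<Rightarrow> real measure \<Rightarrow> bool" where
  "even_moments m \<rho> \<longleftrightarrow> sets \<rho> = sets borel \<and> emeasure \<rho> {..<0} = 0 \<and>
     (\<forall>k. (\<integral>\<^sup>+ r. ennreal (r ^ (2 * k)) \<partial>\<rho>) = ennreal (m k))"

lemma even_moments_prob_space:
  assumes "even_moments m \<rho>" "m 0 = 1"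
  shows "prob_space \<rho>"
proof
  have "(\<integral>\<^sup>+ r. ennreal (r ^ (2 * 0)) \<partial>\<rho>) = ennreal (m 0)"
    using assms unfolding even_moments_def by blast
  then show "emeasure \<rho> (space \<rho>) = 1" using assms by simp
qed

lemma even_moments_atomic_measure:
  assumes w: "\<And>i. i \<in> I \<Longrightarrow> w i \<ge> 0" and x: "\<And>i. i \<in> I \<Longrightarrow> x i \<ge> 0"
    and m: "\<And>k. (\<integral>\<^sup>+ i. ennreal (w i * x i ^ (2 * k)) \<partial>count_space I) = ennreal (m k)"
  shows "even_moments m (atomic_measure I w x)"
proof -
  have "x -` {..<0} \<inter> I = {}" using x by force
  then have "emeasure (atomic_measure I w x) {..<0} = 0"
    by (simp add: atomic_measure_def emeasure_distr)
  moreover have "(\<integral>\<^sup>+ r. ennreal (r ^ (2 * k)) \<partial>atomic_measure I w x) = ennreal (m k)" for k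
  proof -
    have "(\<integral>\<^sup>+ r. ennreal (r ^ (2 * k)) \<partial>atomic_measure I w x) =
        (\<integral>\<^sup>+ i. ennreal (w i) * ennreal (x i ^ (2 * k)) \<partial>count_space I)"
      by (simp add: atomic_measure_def nn_integral_distr nn_integral_density)
    also have "\<dots> = (\<integral>\<^sup>+ i. ennreal (w i * x i ^ (2 * k)) \<partial>count_space I)"
      using w by (intro nn_integral_cong) (simp add: ennreal_mult' )
    finally show ?thesis using m by simp
  qed
  ultimately show ?thesis by (simp add: even_moments_def atomic_measure_def)
qed

lemma even_moments_atomic_measure_sums:
  assumes "\<And>n. w n \<ge> 0" "\<And>n. x n \<ge> 0" "\<And>k. (\<lambda>n. w n * x n ^ (2 * k)) sums m k"
  shows "even_moments m (atomic_measure (UNIV :: nat set) w x)"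
proof (rule even_moments_atomic_measure)
  fix k
  show "(\<integral>\<^sup>+ i. ennreal (w i * x i ^ (2 * k)) \<partial>count_space UNIV) = ennreal (m k)"
    unfolding nn_integral_count_space_nat using assms
    by (intro suminf_ennreal_eq) auto
qed (use assms in auto)

text \<open>
  The Cauchy--Schwarz inequality for \<open>r ^ n\<close> and \<open>r ^ (n + 2)\<close>.
\<close>

lemma even_moments_log_convex:
  assumes em: "even_moments m \<rho>" and pos: "\<And>k. m k \<ge> 0"
  shows "(m (Suc n))\<^sup>2 \<le> m n * m (Suc (Suc n))"
proof -
  have sets [measurable_cong]: "sets \<rho> = sets borel"
    and mom: "\<And>k. (\<integral>\<^sup>+ r. ennreal (r ^ (2 * k)) \<partial>\<rho>) = ennreal (m k)"
    using em by (auto simp: even_moments_def)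
  let ?f = "\<lambda>k r::real. ennreal (\<bar>r\<bar> ^ k)"
  have sq: "(?f k r)\<^sup>2 = ennreal (r ^ (2 * k))" for k r
  proof -
    have "(\<bar>r\<bar> ^ k)\<^sup>2 = (r\<^sup>2) ^ k" 
      by (metis power_mult mult.commute power2_abs)
    then show ?thesis by (simp add: ennreal_power power_mult)
  qed
  have prod: "?f n r * ?f (Suc (Suc n)) r = ennreal (r ^ (2 * Suc n))" for r
  proof -
    have "n + Suc (Suc n) = 2 * Suc n" by simp
    then have "\<bar>r\<bar> ^ n * \<bar>r\<bar> ^ Suc (Suc n) = \<bar>r\<bar> ^ (2 * Suc n)"
      by (metis power_add)
    also have "\<dots> = r ^ (2 * Suc n)" by (simp only: power_even_abs dvd_triv_left)
    finally show ?thesis by (simp only: ennreal_mult'[symmetric] zero_le_power abs_ge_zero)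
  qed
  have "(\<integral>\<^sup>+ r. ?f n r * ?f (Suc (Suc n)) r \<partial>\<rho>)\<^sup>2 \<le>
      (\<integral>\<^sup>+ r. (?f n r)\<^sup>2 \<partial>\<rho>) * (\<integral>\<^sup>+ r. (?f (Suc (Suc n)) r)\<^sup>2 \<partial>\<rho>)"
    by (rule Cauchy_Schwarz_nn_integral) measurable
  then have "(ennreal (m (Suc n)))\<^sup>2 \<le> ennreal (m n) * ennreal (m (Suc (Suc n)))"
    unfolding sq prod mom .
  then show ?thesis
    using pos by (simp add: ennreal_power flip: ennreal_mult)
qed

text \<open>
  The error of the Taylor polynomial of the characteristic function is bounded by
  \<open>2 * (\<bar>t\<bar> * C) ^ n / fact n\<close>, which is a term of a convergent series. On the half-line the
  absolute moment in this bound is the moment itself.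
\<close>

lemma char_moment_series:
  assumes M: "real_distribution M" and nonneg: "AE x in M. x \<ge> 0"
    and int: "\<And>k. integrable M (\<lambda>x. x ^ k)"
    and bound: "\<And>k. (\<integral>x. x ^ k \<partial>M) \<le> C ^ k"
  shows "(\<lambda>n. \<Sum>k\<le>n. ((\<i> * complex_of_real t) ^ k / fact k) * complex_of_real (\<integral>x. x ^ k \<partial>M)) \<longlonglongrightarrow> char M t"
proof -
  interpret real_distribution M by fact
  let ?S = "\<lambda>n. \<Sum>k\<le>n. ((\<i> * complex_of_real t) ^ k / fact k) * complex_of_real (\<integral>x. x ^ k \<partial>M)"
  have bnd: "norm (?S n - char M t) \<le> 2 * ((\<bar>t\<bar> * C) ^ n /\<^sub>R fact n)" for n
  proof -
    have "(\<integral>x. \<bar>x\<bar> ^ n \<partial>M) = (\<integral>x. x ^ n \<partial>M)"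
      by (rule integral_cong_AE) (use nonneg in auto)
    then have "(\<integral>x. \<bar>x\<bar> ^ n \<partial>M) \<le> C ^ n" using bound by simp
    then have "norm (char M t - ?S n) \<le> 2 * \<bar>t\<bar> ^ n / fact n * C ^ n"
      using int
      by (intro order_trans[OF char_approx1[of n t] mult_left_mono]) auto
    then show ?thesis by (simp add: norm_minus_commute power_mult_distrib field_simps)
  qed
  have "(\<lambda>n. 2 * ((\<bar>t\<bar> * C) ^ n /\<^sub>R fact n)) \<longlonglongrightarrow> 2 * 0"
    by (intro tendsto_intros summable_LIMSEQ_zero summable_exp_generic)
  then have "(\<lambda>n. 2 * ((\<bar>t\<bar> * C) ^ n /\<^sub>R fact n)) \<longlonglongrightarrow> 0" by (simp only: mult_zero_right)
  with always_eventually[OF allI[OF bnd]] have "(\<lambda>n. ?S n - char M t) \<longlonglongrightarrow> 0"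
    by (rule Lim_null_comparison)
  then show ?thesis by (simp add: LIM_zero_iff)
qed

text \<open>
  The image of the measure under \<open>r \<mapsto> r\<^sup>2\<close> has the moments \<open>m k\<close>, so its
  characteristic function is determined by them, and hence the image is determined by Levy's
  uniqueness theorem. The square root recovers the measure, which lives on the half-line.
\<close>

lemma even_moments_unique:
  assumes em: "even_moments m \<rho>" "even_moments m \<rho>'" and m0: "m 0 = 1"
    and nonneg: "\<And>k. 0 \<le> m k" and bound: "\<And>k. m k \<le> C ^ k"
  shows "\<rho> = \<rho>'"
proof -
  define sq where "sq \<sigma> = distr \<sigma> borel (\<lambda>r::real. r\<^sup>2)" for \<sigma> :: "real measure"
  have char_lim: "(\<lambda>n. \<Sum>k\<le>n. ((\<i> * complex_of_real t) ^ k / fact k) * complex_of_real (m k))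
      \<longlonglongrightarrow> char (sq \<sigma>) t" and dist: "real_distribution (sq \<sigma>)"
    and distr_sqrt: "\<sigma> = distr (sq \<sigma>) borel sqrt"
    if \<sigma>: "even_moments m \<sigma>" for \<sigma> t
  proof -
    interpret prob_space \<sigma> using \<sigma> m0 by (rule even_moments_prob_space)
    have sets [measurable_cong]: "sets \<sigma> = sets borel"
      and mom: "\<And>k. (\<integral>\<^sup>+ r. ennreal (r ^ (2 * k)) \<partial>\<sigma>) = ennreal (m k)"
      and neg: "emeasure \<sigma> {..<0} = 0"
      using \<sigma> by (auto simp: even_moments_def)
    show dist: "real_distribution (sq \<sigma>)"
      unfolding sq_def by (intro real_distribution_distr) measurable
    have mom': "(\<integral>\<^sup>+ x. ennreal (x ^ k) \<partial>sq \<sigma>) = ennreal (m k)" for k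
      by (simp add: sq_def nn_integral_distr mom flip: power_mult)
    have AE_sq: "AE x in sq \<sigma>. 0 \<le> x"
      unfolding sq_def by (subst AE_distr_iff) auto
    have AE_pow: "AE x in sq \<sigma>. 0 \<le> x ^ k" for k using AE_sq by eventually_elim simp
    have [measurable_cong]: "sets (sq \<sigma>) = sets borel" by (simp add: sq_def)
    have int: "integrable (sq \<sigma>) (\<lambda>x. x ^ k)" for k
      by (rule integrableI_nn_integral_finite[OF _ AE_pow mom']) simp
    have "(\<integral>x. x ^ k \<partial>sq \<sigma>) = m k" for k
      using mom'[of k] AE_pow[of k] nonneg[of k] by (subst integral_eq_nn_integral) auto
    then show "(\<lambda>n. \<Sum>k\<le>n. ((\<i> * complex_of_real t) ^ k / fact k) * complex_of_real (m k))
      \<longlonglongrightarrow> char (sq \<sigma>) t"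
      using char_moment_series[OF dist AE_sq int, of C t] bound by simp
    have "AE r in \<sigma>. 0 \<le> r"
      using neg by (intro AE_I[where N = "{..<0}"]) (auto simp: sets)
    then have "distr \<sigma> \<sigma> (\<lambda>r. r) = distr \<sigma> borel (\<lambda>r. sqrt (r\<^sup>2))"
      by (intro distr_cong_AE) (auto simp: sets)
    then show "\<sigma> = distr (sq \<sigma>) borel sqrt"
      by (simp add: sq_def distr_distr comp_def)
  qed
  have "char (sq \<rho>) = char (sq \<rho>')"
    using char_lim[OF em(1)] char_lim[OF em(2)] by (intro ext LIMSEQ_unique)
  then have "sq \<rho> = sq \<rho>'" using Levy_uniqueness dist em by blast
  then show ?thesis using distr_sqrt em by metis
qed

section \<open>Radial Bargmann representations as moment problems\<close>

text \<open>
  The products are the squared norms of the orthogonal polynomials. Inductively, equal polynomials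
  have equal norms, the quotient of two consecutive norms is the next coefficient, and this
  coefficient determines the next polynomial.
\<close>

lemma orthogonality_measure_norms_unique:
  assumes \<nu>: "orthogonality_measure \<omega> \<nu>" "orthogonality_measure \<omega>' \<nu>"
    and nz: "\<And>k. k \<ge> 1 \<Longrightarrow> \<omega> k \<noteq> 0"
  shows "(\<Prod>k=1..n. \<omega>' k) = (\<Prod>k=1..n. \<omega> k)"
proof -
  have norm: "(\<Prod>k=1..n. \<omega>' k) = (\<Prod>k=1..n. \<omega> k)"
    if "monic_orth_poly \<omega>' n = monic_orth_poly \<omega> n" for n
    using \<nu> that unfolding orthogonality_measure_def by metis
  have "monic_orth_poly \<omega>' n = monic_orth_poly \<omega> n \<and>
      monic_orth_poly \<omega>' (Suc n) = monic_orth_poly \<omega> (Suc n)"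
  proof (induction n)
    case (Suc n)
    have "(\<Prod>k=1..n. \<omega> k) \<noteq> 0" using nz by auto
    then have "\<omega>' (Suc n) = \<omega> (Suc n)"
      using norm[of n] norm[of "Suc n"] Suc.IH by simp
    then show ?case using Suc.IH by simp
  qed simp
  then show ?thesis by (intro norm) blast
qed

abbreviation angle_measure :: "real measure" where
  "angle_measure \<equiv> uniform_measure lborel {0..<2 * pi}"

lemma prob_space_angle_measure: "prob_space angle_measure"
  by (intro prob_space_uniform_measure) auto

lemma borel_measurable_cis [measurable]: "cis \<in> borel_measurable borel"
  by (intro borel_measurable_continuous_onI continuous_intros)

lemma integral_cis_angle_measure:
  assumes k: "k \<in> \<int>" "k \<noteq> 0"
  shows "(\<integral>\<theta>. cis (k * \<theta>) \<partial>angle_measure) = 0"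
proof -
  \<comment> \<open>A real-valued density permits the use of the Bochner integral for densities.\<close>
  have "angle_measure = density lborel (\<lambda>\<theta>. ennreal (indicator {0..<2 * pi} \<theta> / (2 * pi)))"
    unfolding uniform_measure_def
    by (intro arg_cong[where f = "density lborel"] ext)
       (auto simp: indicator_def divide_ennreal simp flip: ennreal_1)
  then have "(\<integral>\<theta>. cis (k * \<theta>) \<partial>angle_measure) =
      (\<integral>\<theta>. (indicator {0..<2 * pi} \<theta> / (2 * pi)) *\<^sub>R cis (k * \<theta>) \<partial>lborel)"
    by (simp add: integral_density)
  also have "\<dots> = (\<integral>\<theta>. (1 / (2 * pi)) *\<^sub>R (indicator {0..2 * pi} \<theta> *\<^sub>R cis (k * \<theta>)) \<partial>lborel)"
  proof (rule integral_cong_AE)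
    show "AE \<theta> in lborel. (indicator {0..<2 * pi} \<theta> / (2 * pi)) *\<^sub>R cis (k * \<theta>) =
        (1 / (2 * pi)) *\<^sub>R (indicator {0..2 * pi} \<theta> *\<^sub>R cis (k * \<theta>))"
      using AE_lborel_singleton[of "2 * pi"]
      by eventually_elim (auto simp: indicator_def)
  qed measurable
  also have "(\<integral>\<theta>. (1 / (2 * pi)) *\<^sub>R (indicator {0..2 * pi} \<theta> *\<^sub>R cis (k * \<theta>)) \<partial>lborel) = 
     (1 / (2 * pi)) *\<^sub>R (\<integral>\<theta>. indicator {0..2 * pi} \<theta> *\<^sub>R cis (k * \<theta>) \<partial>lborel)"
    by (rule integral_scaleR_right)
  also have "(\<integral>\<theta>. indicator {0..2 * pi} \<theta> *\<^sub>R cis (k * \<theta>) \<partial>lborel) =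
      exp (\<i> * of_real k * of_real (2 * pi)) / (\<i> * of_real k) -
      exp (\<i> * of_real k * of_real 0) / (\<i> * of_real k)"
  proof (rule integral_FTC_Icc)
    fix \<theta> :: real
    have "((\<lambda>z. exp (\<i> * of_real k * z) / (\<i> * of_real k)) has_field_derivative
        cis (k * \<theta>)) (at (of_real \<theta>))"
      using k by (auto intro!: derivative_eq_intros simp: cis_conv_exp mult_ac)
    then show "((\<lambda>\<theta>. exp (\<i> * of_real k * of_real \<theta>) / (\<i> * of_real k))
        has_vector_derivative cis (k * \<theta>)) (at \<theta> within {0..2 * pi})"
      by (rule has_vector_derivative_real_field)
  qed (auto intro!: continuous_intros)
  also have "exp (\<i> * of_real k * of_real (2 * pi)) = cis (2 * pi * k)"
    by (simp add: cis_conv_exp mult_ac)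
  also have "cis (2 * pi * k) = 1" using k by (intro cis_multiple_2pi)
  finally show ?thesis by simp
qed

lemma polar_measurable:
  assumes "sets \<rho> = sets borel"
  shows "(\<lambda>(\<theta>, r). complex_of_real r * cis \<theta>) \<in> borel_measurable (angle_measure \<Otimes>\<^sub>M \<rho>)"
proof -
  have [measurable_cong]: "sets \<rho> = sets borel" by fact
  show ?thesis by measurable
qed

lemma radial_with_norm_moment:
  assumes \<gamma>: "radial_with \<gamma> \<rho>" and "prob_space \<rho>"
  shows "(\<integral>\<^sup>+ z. ennreal (norm z ^ k) \<partial>\<gamma>) = (\<integral>\<^sup>+ r. ennreal (\<bar>r\<bar> ^ k) \<partial>\<rho>)"
proof -
  interpret U: prob_space angle_measure by (rule prob_space_angle_measure)
  interpret R: prob_space \<rho> by fact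
  interpret P: pair_prob_space angle_measure \<rho> ..
  have sets [measurable_cong]: "sets \<rho> = sets borel"
    and \<gamma>_eq: "\<gamma> = distr (angle_measure \<Otimes>\<^sub>M \<rho>) borel (\<lambda>(\<theta>, r). complex_of_real r * cis \<theta>)"
    using \<gamma> by (auto simp: radial_with_def)
  have "(\<integral>\<^sup>+ z. ennreal (norm z ^ k) \<partial>\<gamma>) =
      (\<integral>\<^sup>+ p. ennreal (\<bar>snd p\<bar> ^ k) \<partial>(angle_measure \<Otimes>\<^sub>M \<rho>))"
    unfolding \<gamma>_eq
    by (subst nn_integral_distr[OF polar_measurable[OF sets]])
       (auto intro!: nn_integral_cong simp: norm_mult case_prod_beta)
  also have "\<dots> = (\<integral>\<^sup>+ r. (\<integral>\<^sup>+ \<theta>. ennreal (\<bar>snd (\<theta>, r)\<bar> ^ k) \<partial>angle_measure) \<partial>\<rho>)"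
    by (rule P.nn_integral_snd[symmetric]) measurable
  finally show ?thesis using U.emeasure_space_1 by (simp del: emeasure_uniform_measure)
qed

text \<open>
  A measure \<open>\<rho>\<close> that is not \<open>\<sigma>\<close>-finite is possible a priori. If iterated
  integration against it does not define a measure, then the product is the null measure, contrary
  to the total mass of \<open>\<gamma>\<close>; otherwise the mass of the product is that of \<open>\<rho>\<close>.
\<close>

lemma radial_with_prob_space:
  assumes \<gamma>: "radial_with \<gamma> \<rho>" and "prob_space \<gamma>"
  shows "prob_space \<rho>"
proof
  interpret U: prob_space angle_measure by (rule prob_space_angle_measure)
  interpret G: prob_space \<gamma> by fact
  let ?P = "angle_measure \<Otimes>\<^sub>M \<rho>"
  have sets: "sets \<rho> = sets borel"
    and \<gamma>_eq: "\<gamma> = distr ?P borel (\<lambda>(\<theta>, r). complex_of_real r * cis \<theta>)"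
    using \<gamma> by (auto simp: radial_with_def)
  have "emeasure ?P (space ?P) = 1"
    using G.emeasure_space_1 unfolding \<gamma>_eq
    by (subst (asm) emeasure_distr[OF polar_measurable[OF sets]]) auto
  moreover from this have "emeasure ?P (space ?P) = (\<integral>\<^sup>+ \<theta>. (\<integral>\<^sup>+ r. indicator (space ?P) (\<theta>, r) \<partial>\<rho>) \<partial>angle_measure)"
    unfolding pair_measure_def emeasure_measure_of_conv by (auto split: if_splits)
  moreover have "\<dots> = (\<integral>\<^sup>+ \<theta>. emeasure \<rho> (space \<rho>) \<partial>angle_measure)"
    by (intro nn_integral_cong)
       (simp add: space_pair_measure indicator_def cong: nn_integral_cong_simp)
  ultimately show "emeasure \<rho> (space \<rho>) = 1"
    using U.emeasure_space_1 by (simp del: emeasure_uniform_measure)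
qed

text \<open>
  In polar coordinates the integrand is \<open>r ^ (m + n)\<close> times \<open>cis ((n - m) * \<theta>)\<close>, whose
  integral over the angle vanishes.
\<close>

lemma radial_with_mixed_moment:
  assumes \<gamma>: "radial_with \<gamma> \<rho>" and "prob_space \<rho>" and neq: "m \<noteq> n"
    and int: "integrable \<gamma> (\<lambda>z. cnj z ^ m * z ^ n)"
  shows "(\<integral>z. cnj z ^ m * z ^ n \<partial>\<gamma>) = 0"
proof -
  interpret U: prob_space angle_measure by (rule prob_space_angle_measure)
  interpret R: prob_space \<rho> by fact
  interpret P: pair_prob_space angle_measure \<rho> ..
  let ?k = "real n - real m"
  have sets: "sets \<rho> = sets borel"
    and \<gamma>_eq: "\<gamma> = distr (angle_measure \<Otimes>\<^sub>M \<rho>) borel (\<lambda>(\<theta>, r). complex_of_real r * cis \<theta>)"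
    using \<gamma> by (auto simp: radial_with_def)
  have meas: "(\<lambda>z::complex. cnj z ^ m * z ^ n) \<in> borel_measurable borel"
    by (intro borel_measurable_continuous_onI continuous_intros)
  have polar: "cnj (complex_of_real r * cis \<theta>) ^ m * (complex_of_real r * cis \<theta>) ^ n =
      of_real (r ^ (m + n)) * cis (?k * \<theta>)" for r \<theta>
    by (simp add: power_mult_distrib cis_cnj Complex.DeMoivre power_add cis_mult algebra_simps)
  have polar_pair: "(\<lambda>p. cnj (case p of (\<theta>, r) \<Rightarrow> complex_of_real r * cis \<theta>) ^ m *
        (case p of (\<theta>, r) \<Rightarrow> complex_of_real r * cis \<theta>) ^ n) =
      (\<lambda>(\<theta>, r). of_real (r ^ (m + n)) * cis (?k * \<theta>))"
    by (simp only: fun_eq_iff split_paired_All case_prod_conv polar) blast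
  have "integrable (angle_measure \<Otimes>\<^sub>M \<rho>) (\<lambda>(\<theta>, r). of_real (r ^ (m + n)) * cis (?k * \<theta>))"
    using int unfolding \<gamma>_eq integrable_distr_eq[OF polar_measurable[OF sets] meas] polar_pair .
  from P.integral_snd[OF this]
  have "(\<integral>p. (\<lambda>(\<theta>, r). of_real (r ^ (m + n)) * cis (?k * \<theta>)) p \<partial>(angle_measure \<Otimes>\<^sub>M \<rho>)) =
      (\<integral>r. (\<integral>\<theta>. of_real (r ^ (m + n)) * cis (?k * \<theta>) \<partial>angle_measure) \<partial>\<rho>)"
    by simp
  also have "\<dots> = 0"
    using integral_cis_angle_measure[of ?k] neq by simp
  finally show ?thesis
    unfolding \<gamma>_eq integral_distr[OF polar_measurable[OF sets] meas] polar_pair .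
qed

lemma cnj_power_mult_power: "cnj z ^ n * z ^ n = complex_of_real (norm z ^ (2 * n))"
proof -
  have "cnj z * z = complex_of_real ((norm z)\<^sup>2)"
    by (metis complex_norm_square mult.commute)
  then show ?thesis by (simp only: power_mult power_mult_distrib[symmetric] of_real_power)
qed

text \<open>
  The positivity of \<open>\<omega>\<close> makes the coefficients of any other recurrence of \<open>\<nu>\<close>, as they
  may occur in the definition of a Bargmann representation, have the same products.
\<close>

lemma radial_bargmann_measure_iff_even_moments:
  assumes \<nu>: "orthogonality_measure \<omega> \<nu>" and pos: "\<And>k. k \<ge> 1 \<Longrightarrow> \<omega> k > 0"
  shows "radial_bargmann_measure \<nu> \<rho> \<longleftrightarrow> even_moments (\<lambda>n. \<Prod>k=1..n. \<omega> k) \<rho>"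
    (is "_ \<longleftrightarrow> even_moments ?m \<rho>")
proof
  assume "radial_bargmann_measure \<nu> \<rho>"
  then obtain \<gamma> where rep: "bargmann_representation \<nu> \<gamma>" and rad: "radial_with \<gamma> \<rho>"
    by (auto simp: radial_bargmann_measure_def)
  from rep have "prob_space \<gamma>" by (simp add: bargmann_representation_def)
  with rad have \<gamma>: "radial_with \<gamma> \<rho>" "prob_space \<gamma>" .
  from rep obtain \<omega>' where \<nu>': "orthogonality_measure \<omega>' \<nu>"
    and moments: "\<forall>m n. integrable \<gamma> (\<lambda>z. cnj z ^ m * z ^ n) \<and>
           (\<integral>z. cnj z ^ m * z ^ n \<partial>\<gamma>) =
             (if m = n then complex_of_real (\<Prod>k=1..n. \<omega>' k) else 0)"
    unfolding bargmann_representation_def by blast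
  have int: "integrable \<gamma> (\<lambda>z. cnj z ^ m * z ^ n)" for m n using moments by blast
  have mom: "(\<integral>z. cnj z ^ n * z ^ n \<partial>\<gamma>) = complex_of_real (\<Prod>k=1..n. \<omega>' k)" for n
    using moments[rule_format, of n n] by simp
  have "prob_space \<rho>" by (rule radial_with_prob_space[OF \<gamma>])
  have "(\<integral>\<^sup>+ r. ennreal (r ^ (2 * k)) \<partial>\<rho>) = ennreal (?m k)" for k
  proof -
    have int_k: "integrable \<gamma> (\<lambda>z. norm z ^ (2 * k))"
      using integrable_Re[OF int[of k k]] by (simp add: cnj_power_mult_power)
    have "complex_of_real (\<integral>z. norm z ^ (2 * k) \<partial>\<gamma>) = complex_of_real (?m k)"
      using mom[of k] orthogonality_measure_norms_unique[OF \<nu> \<nu>', of k] pos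
      unfolding cnj_power_mult_power integral_complex_of_real by (metis less_irrefl)
    then have "(\<integral>z. norm z ^ (2 * k) \<partial>\<gamma>) = ?m k" by (simp only: of_real_eq_iff)
    then have "(\<integral>\<^sup>+ z. ennreal (norm z ^ (2 * k)) \<partial>\<gamma>) = ennreal (?m k)"
      using nn_integral_eq_integral[OF int_k] by simp
    then show ?thesis
      using radial_with_norm_moment[OF \<gamma>(1) \<open>prob_space \<rho>\<close>, of "2 * k"]
      by (simp add: power_even_abs)
  qed
  with \<gamma> show "even_moments ?m \<rho>" by (simp add: even_moments_def radial_with_def)
next
  assume em: "even_moments ?m \<rho>"
  then interpret R: prob_space \<rho> by (rule even_moments_prob_space) simp
  interpret U: prob_space angle_measure by (rule prob_space_angle_measure)
  interpret P: pair_prob_space angle_measure \<rho> ..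
  define \<gamma> where "\<gamma> = distr (angle_measure \<Otimes>\<^sub>M \<rho>) borel (\<lambda>(\<theta>, r). complex_of_real r * cis \<theta>)"
  have sets [measurable_cong]: "sets \<rho> = sets borel"
    and mom: "\<And>k. (\<integral>\<^sup>+ r. ennreal (r ^ (2 * k)) \<partial>\<rho>) = ennreal (?m k)"
    using em by (auto simp: even_moments_def)
  have rad: "radial_with \<gamma> \<rho>" using em by (simp add: radial_with_def even_moments_def \<gamma>_def)
  have [measurable_cong]: "sets \<gamma> = sets borel" by (simp add: \<gamma>_def)
  note norm_moment = radial_with_norm_moment[OF rad R.prob_space_axioms]
  have meas: "(\<lambda>z::complex. cnj z ^ m * z ^ n) \<in> borel_measurable \<gamma>" for m n
    unfolding measurable_cong_sets[OF \<open>sets \<gamma> = sets borel\<close> refl]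
    by (intro borel_measurable_continuous_onI continuous_intros)
  have int: "integrable \<gamma> (\<lambda>z. cnj z ^ m * z ^ n)" for m n
  proof (rule integrableI_bounded[OF meas])
    have "(\<integral>\<^sup>+ z. ennreal (norm (cnj z ^ m * z ^ n)) \<partial>\<gamma>) = (\<integral>\<^sup>+ r. ennreal (\<bar>r\<bar> ^ (m + n)) \<partial>\<rho>)"
      using norm_moment[of "m + n"] by (simp add: norm_mult norm_power power_add)
    \<comment> \<open>Odd absolute moments are finite since \<open>y \<le> 1 + y\<^sup>2\<close>.\<close>
    also have "\<dots> \<le> (\<integral>\<^sup>+ r. ennreal (r ^ (2 * 0)) + ennreal (r ^ (2 * (m + n))) \<partial>\<rho>)"
    proof (intro nn_integral_mono)
      fix r :: real
      have "\<bar>r\<bar> ^ (m + n) \<le> 1 + (\<bar>r\<bar> ^ (m + n))\<^sup>2"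
        using zero_le_power2[of "\<bar>r\<bar> ^ (m + n) - 1"] zero_le_power[OF abs_ge_zero, of r "m + n"]
        unfolding power2_diff mult_1_right one_power2 by linarith
      also have "(\<bar>r\<bar> ^ (m + n))\<^sup>2 = r ^ (2 * (m + n))"
        by (metis power_even_abs dvd_triv_left power_mult mult.commute)
      finally show "ennreal (\<bar>r\<bar> ^ (m + n)) \<le> ennreal (r ^ (2 * 0)) + ennreal (r ^ (2 * (m + n)))"
        by (simp flip: ennreal_plus ennreal_1 add: zero_le_even_power)
    qed
    also have "\<dots> = ennreal (?m 0) + ennreal (?m (m + n))"
      by (subst nn_integral_add) (simp_all only: mom, measurable)
    also have "\<dots> < \<infinity>" by simp
    finally show "(\<integral>\<^sup>+ z. ennreal (norm (cnj z ^ m * z ^ n)) \<partial>\<gamma>) < \<infinity>" .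
  qed
  have diag: "(\<integral>z. cnj z ^ n * z ^ n \<partial>\<gamma>) = complex_of_real (?m n)" for n
  proof -
    have "(\<integral>\<^sup>+ z. ennreal (norm z ^ (2 * n)) \<partial>\<gamma>) = ennreal (?m n)"
      using norm_moment[of "2 * n"] mom[of n] by (simp add: power_even_abs)
    moreover have "?m n \<ge> 0" using pos by (intro prod_nonneg) (auto intro: less_imp_le)
    ultimately have "(\<integral>z. norm z ^ (2 * n) \<partial>\<gamma>) = ?m n"
      by (subst integral_eq_nn_integral) auto
    then show ?thesis unfolding cnj_power_mult_power integral_complex_of_real by simp
  qed
  have "prob_space \<gamma>" unfolding \<gamma>_def
    by (rule P.prob_space_distr[OF polar_measurable[OF sets]])
  moreover have "(\<integral>z. cnj z ^ m * z ^ n \<partial>\<gamma>) = (if m = n then complex_of_real (?m n) else 0)" for m n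
    using diag radial_with_mixed_moment[OF rad R.prob_space_axioms _ int] by auto
  ultimately have "bargmann_representation \<nu> \<gamma>"
    unfolding bargmann_representation_def using \<nu> int by (auto simp: \<gamma>_def intro!: exI[of _ \<omega>])
  then show "radial_bargmann_measure \<nu> \<rho>"
    using rad by (auto simp: radial_bargmann_measure_def)
qed

section \<open>The q-Meixner--Pollaczek moments\<close>

lemma mp_omega_Suc:
  assumes "\<bar>q\<bar> < 1"
  shows "mp_omega \<alpha> q (Suc n) = (1 - (- \<alpha>) * q ^ n) * (1 - q * q ^ n) / (1 - q)"
  using assms sum_gp_strict[of q "Suc n"] by (auto simp: mp_omega_def q_int_def simp del: sum.lessThan_Suc)

lemma prod_mp_omega:
  assumes "\<bar>q\<bar> < 1"
  shows "(\<Prod>k=1..n. mp_omega \<alpha> q k) = q_poch (- \<alpha>) q n * q_poch q q n / (1 - q) ^ n"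
  by (induction n) (simp_all add: q_poch_Suc mp_omega_Suc[OF assms] mult_ac)

lemma mp_omega_Suc_bounds:
  assumes \<alpha>: "\<bar>\<alpha>\<bar> < 1" and q: "\<bar>q\<bar> < 1"
  shows "0 < mp_omega \<alpha> q (Suc n)" "mp_omega \<alpha> q (Suc n) \<le> 4 / (1 - q)"
proof -
  let ?x = "1 - (- \<alpha>) * q ^ n" and ?y = "1 - q * q ^ n"
  have x: "0 < ?x" "?x \<le> 2" using abs_mult_power_less_1[OF \<alpha> q, of n] by auto
  have y: "0 < ?y" "?y \<le> 2" using abs_mult_power_less_1[OF q q, of n] by auto
  have "?x * ?y \<le> 2 * 2" using x y by (intro mult_mono) auto
  then show "0 < mp_omega \<alpha> q (Suc n)" "mp_omega \<alpha> q (Suc n) \<le> 4 / (1 - q)"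
    unfolding mp_omega_Suc[OF q] using x y q
    by (simp_all add: divide_right_mono)
qed

text \<open>
  The geometric growth that makes the moment problem determinate.
\<close>

lemma prod_mp_omega_le:
  assumes \<alpha>: "\<bar>\<alpha>\<bar> < 1" and q: "\<bar>q\<bar> < 1"
  shows "(\<Prod>k=1..n. mp_omega \<alpha> q k) \<le> (4 / (1 - q)) ^ n"
proof -
  have "mp_omega \<alpha> q k \<le> 4 / (1 - q) \<and> 0 < mp_omega \<alpha> q k" if "k \<ge> 1" for k
    using mp_omega_Suc_bounds[OF assms, of "k - 1"] that by simp
  then have "(\<Prod>k=1..n. mp_omega \<alpha> q k) \<le> (\<Prod>k=1..n. 4 / (1 - q))"
    by (intro prod_mono) (auto intro: less_imp_le)
  then show ?thesis by simp
qed

text \<open>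
  Log-convexity of the moments, divided by a positive factor.
\<close>

lemma even_moments_prod_incseq:
  assumes em: "even_moments (\<lambda>n. \<Prod>k=1..n. \<omega> k) \<rho>" and pos: "\<And>n. \<omega> (Suc n) > 0"
  shows "incseq (\<lambda>n. \<omega> (Suc n))"
proof (rule incseq_SucI)
  fix n
  let ?m = "\<lambda>n. \<Prod>k=1..n. \<omega> k"
  have "\<omega> k > 0" if "k \<ge> 1" for k using pos[of "k - 1"] that by simp
  then have m: "?m n > 0" for n by (intro prod_pos) auto
  have "(?m (Suc n))\<^sup>2 \<le> ?m n * ?m (Suc (Suc n))"
    using m by (intro even_moments_log_convex[OF em] less_imp_le)
  then have "(?m n * ?m n * \<omega> (Suc n)) * \<omega> (Suc n) \<le> (?m n * ?m n * \<omega> (Suc n)) * \<omega> (Suc (Suc n))"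
    by (simp add: power2_eq_square mult_ac)
  moreover have "?m n * ?m n * \<omega> (Suc n) > 0" using m[of n] pos[of n] by simp
  ultimately show "\<omega> (Suc n) \<le> \<omega> (Suc (Suc n))" by (simp only: mult_le_cancel_left_pos)
qed

text \<open>
  An increasing sequence lies below its limit. Applied to \<open>mp_omega\<close>, this yields one inequality
  for each \<open>n\<close>, and \<open>q ^ n\<close> decides its direction.
\<close>

lemma even_moments_mp_omega_imp:
  assumes \<alpha>: "\<bar>\<alpha>\<bar> < 1" and q: "\<bar>q\<bar> < 1"
    and em: "even_moments (\<lambda>n. \<Prod>k=1..n. mp_omega \<alpha> q k) \<rho>"
  shows "(q \<ge> 0 \<and> \<alpha> \<le> q) \<or> (\<alpha> = q \<and> q \<noteq> 0)"
proof -
  let ?f = "\<lambda>n. \<alpha> - q - \<alpha> * q ^ Suc n"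
  have "incseq (\<lambda>n. mp_omega \<alpha> q (Suc n))"
    using mp_omega_Suc_bounds[OF \<alpha> q] by (intro even_moments_prod_incseq[OF em])
  moreover have "(\<lambda>n. mp_omega \<alpha> q (Suc n)) \<longlonglongrightarrow> (1 - (- \<alpha>) * 0) * (1 - q * 0) / (1 - q)"
    unfolding mp_omega_Suc[OF q]
    by (intro tendsto_intros LIMSEQ_power_zero) (use q in auto)
  ultimately have "mp_omega \<alpha> q (Suc n) \<le> 1 / (1 - q)" for n
    using incseq_le[of "\<lambda>n. mp_omega \<alpha> q (Suc n)"] by simp
  then have "(1 - (- \<alpha>) * q ^ n) * (1 - q * q ^ n) \<le> 1" for n
    unfolding mp_omega_Suc[OF q] using q by (simp add: divide_le_cancel)
  then have key: "q ^ n * ?f n \<le> 0" for n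
    by (simp add: algebra_simps)
  show ?thesis
  proof (cases "q = 0")
    case True
    then show ?thesis using key[of 0] by simp
  next
    case False
    have lim: "?f \<longlonglongrightarrow> \<alpha> - q - \<alpha> * 0"
      by (intro tendsto_intros LIMSEQ_Suc LIMSEQ_power_zero) (use q in auto)
    \<comment> \<open>Along the even indices \<open>q ^ n\<close> is positive, whatever the sign of \<open>q\<close>.\<close>
    have "?f (2 * n) \<le> 0" for n
      using key[of "2 * n"] False by (simp add: mult_le_0_iff not_le[symmetric] zero_le_even_power)
         (metis False power_eq_0_iff zero_le_even_power dvd_triv_left antisym)
    moreover have "(\<lambda>n. ?f (2 * n)) \<longlonglongrightarrow> \<alpha> - q"
      using LIMSEQ_subseq_LIMSEQ[OF lim, of "\<lambda>n. 2 * n"] by (simp add: strict_mono_def comp_def)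
    ultimately have le: "\<alpha> \<le> q" using LIMSEQ_le_const2[of "\<lambda>n. ?f (2 * n)" "\<alpha> - q" 0] by auto
    show ?thesis
    proof (cases "q > 0")
      case False
      with \<open>q \<noteq> 0\<close> have "q < 0" by simp
      then have "?f (2 * n + 1) \<ge> 0" for n
        using key[of "2 * n + 1"] power_less_zero_eq[of q "2 * n + 1"]
        by (simp add: mult_le_0_iff)
      moreover have "(\<lambda>n. ?f (2 * n + 1)) \<longlonglongrightarrow> \<alpha> - q"
        using LIMSEQ_subseq_LIMSEQ[OF lim, of "\<lambda>n. 2 * n + 1"] by (simp add: strict_mono_def comp_def)
      ultimately have "\<alpha> \<ge> q" using LIMSEQ_le_const[of "\<lambda>n. ?f (2 * n + 1)" "\<alpha> - q" 0] by auto
      with le \<open>q \<noteq> 0\<close> show ?thesis by simp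
    qed (use le in auto)
  qed
qed

section \<open>The explicit radial measures\<close>

lemma even_moments_two_atoms:
  assumes "\<bar>\<alpha>\<bar> < 1" "\<alpha> \<le> 0"
  shows "even_moments (\<lambda>n. \<Prod>k=1..n. mp_omega \<alpha> 0 k)
    (atomic_measure {0, 1} (\<lambda>x. if x = 0 then - \<alpha> else 1 + \<alpha>) (\<lambda>x. x))"
proof (rule even_moments_atomic_measure)
  fix k
  have q_poch: "q_poch a 0 k = (if k = 0 then 1 else 1 - a)" for a
    by (induction k) (auto simp: q_poch_Suc)
  have prod: "(\<Prod>k=1..k. mp_omega \<alpha> 0 k) = q_poch (- \<alpha>) 0 k * q_poch 0 0 k"
    using prod_mp_omega[of 0 \<alpha> k] by simp
  show "(\<integral>\<^sup>+ i. ennreal ((if i = 0 then - \<alpha> else 1 + \<alpha>) * i ^ (2 * k)) \<partial>count_space {0, 1 :: real}) =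
      ennreal (\<Prod>k=1..k. mp_omega \<alpha> 0 k)"
    using assms unfolding prod
    by (simp add: nn_integral_count_space_finite q_poch power_0_left flip: ennreal_plus)
qed (use assms in auto)

lemma powr_minus_half_power:
  assumes "x > (0::real)"
  shows "(x powr (- 1 / 2)) ^ (2 * k) = 1 / x ^ k"
proof -
  have "(x powr (- 1 / 2)) ^ 2 = x powr (- 1)"
    by (simp add: power2_eq_square flip: powr_add)
  then show ?thesis using assms by (simp add: power_mult powr_minus_divide power_one_over)
qed

text \<open>
  The moment of order \<open>2 * k\<close> is the generating function of the Rogers--Szegoe polynomials at
  \<open>t = q * q ^ k\<close> and \<open>z = - \<alpha> / q\<close>, where \<open>z * t = - \<alpha> * q ^ k\<close>; so both
  factors are \<open>q\<close>-exponentials at the points needed for the two shifted factorials.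
\<close>

lemma even_moments_rogers_szego_atoms:
  assumes \<alpha>: "\<bar>\<alpha>\<bar> < 1" and q: "\<bar>q\<bar> < 1" "q > 0" "\<alpha> \<le> q"
  shows "even_moments (\<lambda>n. \<Prod>k=1..n. mp_omega \<alpha> q k)
    (atomic_measure UNIV
       (\<lambda>n. q_poch_inf (- \<alpha>) q * q_poch_inf q q *
          (q ^ n / q_poch q q n * rogers_szego n (- \<alpha> * inverse q) q))
       (\<lambda>n. (1 - q) powr (- 1 / 2) * q powr (real n / 2)))"
proof (rule even_moments_atomic_measure_sums)
  have \<alpha>': "\<bar>- \<alpha>\<bar> < 1" using \<alpha> by simp
  let ?z = "- \<alpha> * inverse q" and ?A = "q_poch_inf (- \<alpha>) q * q_poch_inf q q"
  have rs: "q ^ n / q_poch q q n * rogers_szego n ?z q = q ^ n * rs_coeff q ?z n" for n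
    using rogers_szego_eq_rs_coeff[OF q(1), of n ?z] by (metis times_divide_eq_left times_divide_eq_right)
  have z: "?z \<ge> -1" using q by (simp add: field_simps)
  show "0 \<le> ?A * (q ^ n / q_poch q q n * rogers_szego n ?z q)" for n
    unfolding rs using rs_coeff_nonneg[OF q(1) z] q_poch_inf_nonneg[OF \<alpha>' q(1)]
      q_poch_inf_nonneg[OF q(1) q(1)] q by simp
  fix k
  let ?t = "q * q ^ k"
  have zt: "?z * ?t = - \<alpha> * q ^ k" using q by simp
  have "(\<lambda>n. ?A / (1 - q) ^ k * (?t ^ n * rs_coeff q ?z n)) sums
      (?A / (1 - q) ^ k * (q_exp q (?z * ?t) * q_exp q ?t))"
    using abs_mult_power_less_1[OF \<alpha>' q(1), of k] abs_mult_power_less_1[OF q(1) q(1), of k]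
    unfolding zt[symmetric] by (intro sums_mult rs_coeff_sums q(1))
  moreover have "?A / (1 - q) ^ k * (q_exp q (?z * ?t) * q_exp q ?t) =
      (\<Prod>k=1..k. mp_omega \<alpha> q k)"
  proof -
    have "?A / (1 - q) ^ k * (q_exp q (?z * ?t) * q_exp q ?t) =
        (q_poch_inf (- \<alpha>) q * q_exp q (- \<alpha> * q ^ k)) * (q_poch_inf q q * q_exp q ?t) / (1 - q) ^ k"
      unfolding zt by (simp add: mult_ac)
    then show ?thesis
      by (simp only: q_poch_inf_mult_q_exp_shift[OF q(1) \<alpha>'] q_poch_inf_mult_q_exp_shift[OF q(1) q(1)]
        prod_mp_omega[OF q(1)])
  qed
  moreover have "?A / (1 - q) ^ k * (?t ^ n * rs_coeff q ?z n) =
      ?A * (q ^ n / q_poch q q n * rogers_szego n ?z q) *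
        ((1 - q) powr (- 1 / 2) * q powr (real n / 2)) ^ (2 * k)" for n
  proof -
    have "(q powr (real n / 2)) ^ 2 = q ^ n"
      using q by (simp add: power2_eq_square powr_realpow flip: powr_add)
    then have "((1 - q) powr (- 1 / 2) * q powr (real n / 2)) ^ (2 * k) = 1 / (1 - q) ^ k * (q ^ n) ^ k"
      using q powr_minus_half_power[of "1 - q" k]
      by (simp only: power_mult_distrib power_mult[of "q powr _"])
    then show ?thesis unfolding rs by (simp add: power_mult_distrib mult_ac flip: power_mult)
  qed
  ultimately show "(\<lambda>n. ?A * (q ^ n / q_poch q q n * rogers_szego n ?z q) *
      ((1 - q) powr (- 1 / 2) * q powr (real n / 2)) ^ (2 * k)) sums (\<Prod>k=1..k. mp_omega \<alpha> q k)"
    by (simp only:)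
qed simp

text \<open>
  For \<open>\<alpha> = q\<close> the two shifted factorials multiply to one in base \<open>q\<^sup>2\<close>.
\<close>

lemma even_moments_diagonal_atoms:
  assumes q: "\<bar>q\<bar> < 1"
  shows "even_moments (\<lambda>n. \<Prod>k=1..n. mp_omega q q k)
    (atomic_measure UNIV
       (\<lambda>n. q_poch_inf (q ^ 2) (q ^ 2) * (q ^ (2 * n) / q_poch (q ^ 2) (q ^ 2) n))
       (\<lambda>n. (1 - q) powr (- 1 / 2) * \<bar>q\<bar> ^ n))"
proof (rule even_moments_atomic_measure_sums)
  let ?p = "q ^ 2"
  have p: "\<bar>?p\<bar> < 1" using q by (simp add: abs_square_less_1)
  show "0 \<le> q_poch_inf ?p ?p * (q ^ (2 * n) / q_poch ?p ?p n)" for n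
    using q_poch_inf_nonneg[OF p p] q_poch_pos[OF p p, of n]
    by (simp add: power_mult)
  fix k
  let ?t = "?p * ?p ^ k"
  have "(\<lambda>n. q_poch_inf ?p ?p / (1 - q) ^ k * (?t ^ n / q_poch ?p ?p n)) sums
      (q_poch_inf ?p ?p / (1 - q) ^ k * q_exp ?p ?t)"
    by (intro sums_mult q_exp_sums p abs_mult_power_less_1)
  moreover have "q_poch (- q) q k * q_poch q q k = q_poch ?p ?p k"
    by (induction k) (simp_all add: q_poch_Suc power2_eq_square power_mult_distrib algebra_simps)
  then have "q_poch_inf ?p ?p / (1 - q) ^ k * q_exp ?p ?t = (\<Prod>k=1..k. mp_omega q q k)"
    unfolding prod_mp_omega[OF q] using q_poch_inf_mult_q_exp_shift[OF p p, of k] by simp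
  moreover have "q_poch_inf ?p ?p / (1 - q) ^ k * (?t ^ n / q_poch ?p ?p n) =
      q_poch_inf ?p ?p * (q ^ (2 * n) / q_poch ?p ?p n) *
        ((1 - q) powr (- 1 / 2) * \<bar>q\<bar> ^ n) ^ (2 * k)" for n
  proof -
    have "(\<bar>q\<bar> ^ n) ^ (2 * k) = (?p ^ k) ^ n"
      by (metis power_mult power2_abs mult.commute)
    then have "((1 - q) powr (- 1 / 2) * \<bar>q\<bar> ^ n) ^ (2 * k) = 1 / (1 - q) ^ k * (?p ^ k) ^ n"
      using q powr_minus_half_power[of "1 - q" k] by (simp only: power_mult_distrib)
    then show ?thesis by (simp add: power_mult_distrib mult_ac flip: power_mult)
  qed
  ultimately show "(\<lambda>n. q_poch_inf ?p ?p * (q ^ (2 * n) / q_poch ?p ?p n) *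
      ((1 - q) powr (- 1 / 2) * \<bar>q\<bar> ^ n) ^ (2 * k)) sums (\<Prod>k=1..k. mp_omega q q k)"
    by (simp only:)
qed simp

theorem theorem3p11:
  fixes \<alpha> q :: real and \<nu> :: "real measure"
  assumes "\<alpha> \<in> {-1<..<1}" and "q \<in> {-1<..<1}"
    and "orthogonality_measure (mp_omega \<alpha> q) \<nu>"
  shows "((\<exists>\<rho>. radial_bargmann_measure \<nu> \<rho>) \<longleftrightarrow>
            (q \<ge> 0 \<and> \<alpha> \<le> q) \<or> (\<alpha> = q \<and> q \<noteq> 0)) \<and>
         (\<alpha> \<le> q \<and> q = 0 \<longrightarrow>
            (\<forall>\<rho>. radial_bargmann_measure \<nu> \<rho> \<longleftrightarrow>
               \<rho> = atomic_measure {0, 1} (\<lambda>x. if x = 0 then - \<alpha> else 1 + \<alpha>) (\<lambda>x. x))) \<and>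
         (q > 0 \<and> \<alpha> < q \<longrightarrow>
            (\<forall>\<rho>. radial_bargmann_measure \<nu> \<rho> \<longleftrightarrow>
               \<rho> = atomic_measure UNIV
                 (\<lambda>n. q_poch_inf (- \<alpha>) q * q_poch_inf q q *
                       (q ^ n / q_poch q q n * rogers_szego n (- \<alpha> * inverse q) q))
                 (\<lambda>n. (1 - q) powr (- 1 / 2) * q powr (real n / 2)))) \<and>
         (\<alpha> = q \<and> q \<noteq> 0 \<longrightarrow>
            (\<forall>\<rho>. radial_bargmann_measure \<nu> \<rho> \<longleftrightarrow>
               \<rho> = atomic_measure UNIV
                 (\<lambda>n. q_poch_inf (q ^ 2) (q ^ 2) * (q ^ (2 * n) / q_poch (q ^ 2) (q ^ 2) n))
                 (\<lambda>n. (1 - q) powr (- 1 / 2) * \<bar>q\<bar> ^ n)))"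
proof -
  have \<alpha>: "\<bar>\<alpha>\<bar> < 1" and q: "\<bar>q\<bar> < 1" using assms by auto
  let ?m = "\<lambda>n. \<Prod>k=1..n. mp_omega \<alpha> q k"
  have pos: "mp_omega \<alpha> q k > 0" if "k \<ge> 1" for k
    using mp_omega_Suc_bounds[OF \<alpha> q, of "k - 1"] that by simp
  have nonneg: "?m n \<ge> 0" for n using pos by (intro prod_nonneg) (auto intro: less_imp_le)
  have iff: "radial_bargmann_measure \<nu> \<rho> \<longleftrightarrow> even_moments ?m \<rho>" for \<rho>
    by (rule radial_bargmann_measure_iff_even_moments[OF assms(3) pos])
  have unique: "radial_bargmann_measure \<nu> \<rho> \<longleftrightarrow> \<rho> = \<rho>'" if "even_moments ?m \<rho>'" for \<rho> \<rho>'
  proof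
    assume "radial_bargmann_measure \<nu> \<rho>"
    then have "even_moments ?m \<rho>" by (simp only: iff)
    then show "\<rho> = \<rho>'"
      by (rule even_moments_unique[OF _ that _ nonneg prod_mp_omega_le[OF \<alpha> q]]) simp
  next
    assume "\<rho> = \<rho>'"
    with that show "radial_bargmann_measure \<nu> \<rho>" by (simp only: iff)
  qed
  have "(\<exists>\<rho>. radial_bargmann_measure \<nu> \<rho>) \<longrightarrow> (q \<ge> 0 \<and> \<alpha> \<le> q) \<or> (\<alpha> = q \<and> q \<noteq> 0)"
    unfolding iff using even_moments_mp_omega_imp[OF \<alpha> q] by blast
  moreover have 1: "\<forall>\<rho>. radial_bargmann_measure \<nu> \<rho> \<longleftrightarrow>
      \<rho> = atomic_measure {0, 1} (\<lambda>x. if x = 0 then - \<alpha> else 1 + \<alpha>) (\<lambda>x. x)"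
    if "\<alpha> \<le> q \<and> q = 0"
    using even_moments_two_atoms[OF \<alpha>] that by (intro allI unique) simp
  moreover have 2: "\<forall>\<rho>. radial_bargmann_measure \<nu> \<rho> \<longleftrightarrow>
      \<rho> = atomic_measure UNIV
        (\<lambda>n. q_poch_inf (- \<alpha>) q * q_poch_inf q q *
              (q ^ n / q_poch q q n * rogers_szego n (- \<alpha> * inverse q) q))
        (\<lambda>n. (1 - q) powr (- 1 / 2) * q powr (real n / 2))"
    if "q > 0 \<and> \<alpha> < q"
    using that by (intro allI unique even_moments_rogers_szego_atoms \<alpha> q) auto
  moreover have 3: "\<forall>\<rho>. radial_bargmann_measure \<nu> \<rho> \<longleftrightarrow>
      \<rho> = atomic_measure UNIV
        (\<lambda>n. q_poch_inf (q ^ 2) (q ^ 2) * (q ^ (2 * n) / q_poch (q ^ 2) (q ^ 2) n))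
        (\<lambda>n. (1 - q) powr (- 1 / 2) * \<bar>q\<bar> ^ n)"
    if "\<alpha> = q \<and> q \<noteq> 0"
    using even_moments_diagonal_atoms[OF q] that by (intro allI unique) simp
  moreover have "\<exists>\<rho>. radial_bargmann_measure \<nu> \<rho>" if cond: "(q \<ge> 0 \<and> \<alpha> \<le> q) \<or> (\<alpha> = q \<and> q \<noteq> 0)"
  proof -
    consider "\<alpha> \<le> q \<and> q = 0" | "q > 0 \<and> \<alpha> < q" | "\<alpha> = q \<and> q \<noteq> 0"
      using cond by (metis less_le)
    then show ?thesis using 1 2 3 by cases blast+
  qed
  ultimately show ?thesis by blast
qed

end
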